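(* Let $k\ge3$, $a\in\mathbb{N}$ with $a\ge1$, and $i\in\mathbb{N}$, and set $B=(ki)\oplus(a.k)=(ki+a\,.\,ki+k)$. Then, as formal power series, \[ C_B^{(k)}(y)=y^{a+ki}\,\bigl(H_{k-1}(y)\bigr)^{i+1}\Bigl(y^{k-1}+[a>k]\,G_{k-1}(y)\Bigr). \]
   Context: Words are over the alphabet $\mathbb{N}=\{0,1,2,\dots\}$; $(x.y)$ denotes the length-2 word with letters $x,y$; $n\oplus W$ adds $n$ to every letter of $W$. For $k\ge 2$, $\phi_k$ is the morphism of $\mathbb{N}^*$ defined for $i\in\mathbb{N}$, $0\le j\le k-1$ by $\phi_k(ki+j)=(ki)(ki+j+1)$ if $0\le j\le k-2$ and $\phi_k(ki+k-1)=ki+k$; $W_n^{(k)}=\phi_k^n(0)$. For a nonempty word $B$, $c^{(k)}(B;n)$ is the number of (possibly overlapping) occurrences of $B$ in $W_n^{(k)}$ and $C_B^{(k)}(y)=\sum_{n\ge0}c^{(k)}(B;n)y^n$. $H_{k-1}(y)=1/(1-y-\cdots-y^{k-1})$ as a formal power series. For $m\ge2$, $(g_n^{(m)})$ is defined by $g_0^{(m)}=0$, $g_n^{(m)}=2^{n-1}$ for $1\le n\le m-1$, $g_n^{(m)}=g_{n-1}^{(m)}+\cdots+g_{n-m}^{(m)}$ for $n\ge m$, and $G_m(y)=\sum_n g_n^{(m)}y^n$. $[P]$ is the Iverson bracket. *)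

theory Defs
  imports "HOL-Computational_Algebra.Formal_Power_Series"
begin

text \<open>Words over the natural numbers are lists; all definitions are meant for
  \<open>k \<ge> 2\<close> and \<open>m \<ge> 2\<close> (\<open>m \<ge> 1\<close> for \<open>H\<close>).\<close>

definition shift_word :: "nat \<Rightarrow> nat list \<Rightarrow> nat list" where
  "shift_word n w = map (\<lambda>x. n + x) w"

text \<open>The letter \<open>x\<close> is written as \<open>k * i + j\<close> with \<open>0 \<le> j \<le> k - 1\<close>; the \<open>else\<close> branch
  is the case \<open>j = k - 1\<close>.\<close>

definition phi_letter :: "nat \<Rightarrow> nat \<Rightarrow> nat list" where
  "phi_letter k x = (let i = x div k; j = x mod k in
     if j \<le> k - 2 then [k * i, k * i + j + 1] else [k * i + k])"

definition phi :: "nat \<Rightarrow> nat list \<Rightarrow> nat list" where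
  "phi k w = concat (map (phi_letter k) w)"

definition W :: "nat \<Rightarrow> nat \<Rightarrow> nat list" where
  "W k n = (phi k ^^ n) [0]"

text \<open>Occurrences are counted by their starting positions, so overlapping ones are included.\<close>

definition occurrences :: "nat list \<Rightarrow> nat list \<Rightarrow> nat" where
  "occurrences B w = card {p. p + length B \<le> length w \<and> take (length B) (drop p w) = B}"

definition C :: "nat \<Rightarrow> nat list \<Rightarrow> rat fps" where
  "C k B = Abs_fps (\<lambda>n. of_nat (occurrences B (W k n)))"

definition H :: "nat \<Rightarrow> rat fps" where
  "H m = 1 / (1 - (\<Sum>j = 1..m. fps_X ^ j))"

context
  notes sum.cong [fundef_cong]
begin

fun g :: "nat \<Rightarrow> nat \<Rightarrow> nat" where
  "g m n = (if n = 0 then 0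
            else if n < m then 2 ^ (n - 1)
            else (\<Sum>j = 1..m. g m (n - j)))"

end

text \<open>The defining equation of \<open>g\<close> would loop as a rewrite rule.\<close>

declare g.simps [simp del]

definition G :: "nat \<Rightarrow> rat fps" where
  "G m = Abs_fps (\<lambda>n. of_nat (g m n))"

end

theory Submission
  imports Defs
begin

text \<open>
  For \<open>j \<le> k - 2\<close> we have \<open>phi ^ (n + 1) [j] = W n @ phi ^ n [j + 1]\<close>, whereas
  \<open>phi ^ (n + 1) [k - 1] = phi ^ n [k]\<close> is \<open>W n\<close> shifted by \<open>k\<close>. A two-letter word
  occurring in a concatenation lies in one of the factors or straddles the junction. As
  \<open>W n\<close> ends in the letter \<open>n\<close>, the word \<open>[x, z]\<close> can straddle a junction only for
  \<open>n = x\<close>, and telescoping over \<open>j\<close> turns the generating function of its occurrences into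
  \<open>H (k - 1)\<close> times an explicit polynomial plus the contribution of the shifted word. The latter
  reduces \<open>i\<close> by one, and for \<open>i = 0\<close> it leads to the word \<open>[a - k, 0]\<close>, whose
  generating function is \<open>fps_X ^ (a - k) * G (k - 1)\<close>.
\<close>

section \<open>Occurrences of two-letter words\<close>

lemma occurrences_pair_Nil: "occurrences [x, z] [] = 0"
  by (simp add: occurrences_def)

lemma occurrences_pair_Cons:
  "occurrences [x, z] (u # w) =
     occurrences [x, z] w + of_bool (w \<noteq> [] \<and> u = x \<and> hd w = z)"
proof -
  let ?S = "\<lambda>w. {p. p + length [x, z] \<le> length w \<and> take (length [x, z]) (drop p w) = [x, z]}"
  let ?T = "if w \<noteq> [] \<and> u = x \<and> hd w = z then {0} else ({} :: nat set)"
  \<comment> \<open>A starting position in \<open>u # w\<close> is either 0 or the successor of one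
    in \<open>w\<close>; only position 0 involves \<open>u\<close>.\<close>
  have "p \<in> ?S (u # w) \<longleftrightarrow> p \<in> Suc ` ?S w \<union> ?T" for p
    by (cases p; cases w) (auto simp: image_iff)
  then have *: "?S (u # w) = Suc ` ?S w \<union> ?T"
    by blast
  have "finite (?S w)"
    by (rule finite_subset[of _ "{..length w}"]) auto
  then have "card (Suc ` ?S w \<union> ?T) = card (Suc ` ?S w) + card ?T"
    by (intro card_Un_disjoint) auto
  also have "card (Suc ` ?S w) = card (?S w)"
    by (simp add: card_image)
  finally show ?thesis
    unfolding occurrences_def * by simp
qed

lemma occurrences_pair_append:
  assumes "u \<noteq> []" "v \<noteq> []"
  shows "occurrences [x, z] (u @ v) =
     occurrences [x, z] u + occurrences [x, z] v + of_bool (last u = x \<and> hd v = z)"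
  using assms(1)
proof (induction u rule: list_nonempty_induct)
  case (single c)
  then show ?case
    using assms(2) by (simp add: occurrences_pair_Cons occurrences_pair_Nil)
next
  case (cons c cs)
  then show ?case
    by (simp add: occurrences_pair_Cons)
qed

lemma occurrences_eq_0:
  assumes "y \<in> set B" "y \<notin> set w"
  shows "occurrences B w = 0"
proof -
  have "take (length B) (drop p w) \<noteq> B" for p
    using assms by (metis in_set_dropD in_set_takeD)
  then show ?thesis
    by (simp add: occurrences_def)
qed

lemma occurrences_shift_word:
  "occurrences (shift_word n B) (shift_word n w) = occurrences B w"
proof -
  have "map ((+) n) u = map ((+) n) v \<longleftrightarrow> u = v" for u v
    by (rule inj_map_eq_map) simp
  then show ?thesis
    by (simp add: occurrences_def shift_word_def drop_map take_map)
qed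

section \<open>Iterates of the morphism\<close>

lemma phi_append: "phi k (u @ v) = phi k u @ phi k v"
  by (simp add: phi_def)

lemma phi_pow_append: "(phi k ^^ n) (u @ v) = (phi k ^^ n) u @ (phi k ^^ n) v"
  by (induction n) (simp_all add: phi_append)

lemma phi_eq_Nil_iff: "phi k w = [] \<longleftrightarrow> w = []"
  by (cases w) (auto simp: phi_def phi_letter_def Let_def)

lemma phi_pow_eq_Nil_iff: "(phi k ^^ n) w = [] \<longleftrightarrow> w = []"
  by (induction n) (simp_all add: phi_eq_Nil_iff)

lemma hd_phi: "w \<noteq> [] \<Longrightarrow> hd (phi k w) = hd (phi_letter k (hd w))"
  by (cases w) (auto simp: phi_def phi_letter_def Let_def)

lemma last_phi_letter:
  assumes "k \<ge> 2"
  shows "last (phi_letter k x) = Suc x"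
proof (cases "x mod k \<le> k - 2")
  case True
  then show ?thesis
    by (simp add: phi_letter_def)
next
  case False
  moreover have "x mod k < k"
    using assms by simp
  ultimately have "Suc (x mod k) = k"
    by linarith
  then have "k * (x div k) + k = Suc x"
    by (metis add_Suc_right mult_div_mod_eq)
  then show ?thesis
    using False by (simp add: phi_letter_def)
qed

lemma last_phi:
  assumes "k \<ge> 2" "w \<noteq> []"
  shows "last (phi k w) = Suc (last w)"
proof -
  have "phi k w = phi k (butlast w) @ phi_letter k (last w)"
    using phi_append[of k "butlast w" "[last w]"] assms(2) by (simp add: phi_def)
  moreover have "phi_letter k (last w) \<noteq> []"
    by (simp add: phi_letter_def Let_def)
  ultimately show ?thesis
    using last_phi_letter[OF assms(1)] by simp
qed

lemma last_W: "k \<ge> 2 \<Longrightarrow> last (W k n) = n"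
  unfolding W_def by (induction n) (simp_all add: last_phi phi_pow_eq_Nil_iff)

text \<open>The first application of \<open>phi\<close> produces a word beginning with 0, or with
  \<open>k\<close> if \<open>j = k - 1\<close>. Both are multiples of \<open>k\<close>, and the
  image of a multiple of \<open>k\<close> begins with that multiple, so the first letter never
  changes again.\<close>

lemma hd_phi_pow:
  assumes "k \<ge> 2" "j < k" "n > 0"
  shows "hd ((phi k ^^ n) [j]) = (if j = k - 1 then k else 0)"
  using assms(3)
proof (induction n rule: nat_induct_non_zero)
  case 1
  then show ?case
    using assms(1,2) by (auto simp: phi_def phi_letter_def)
next
  case (Suc n)
  then show ?case
    using assms(1) by (simp add: hd_phi phi_pow_eq_Nil_iff phi_letter_def)
qed

text \<open>Adding \<open>k\<close> to a letter raises its quotient by one and keeps its remainder,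
  so the same branch of \<open>phi_letter\<close> applies.\<close>

lemma phi_shift_word:
  assumes "k > 0"
  shows "phi k (shift_word k w) = shift_word k (phi k w)"
  using assms
  by (induction w) (simp_all add: phi_def shift_word_def phi_letter_def Let_def)

lemma phi_pow_shift_word:
  "k > 0 \<Longrightarrow> (phi k ^^ n) (shift_word k w) = shift_word k ((phi k ^^ n) w)"
  by (induction n) (simp_all add: phi_shift_word)

lemma phi_pow_Suc_letter:
  assumes "j < k - 1"
  shows "(phi k ^^ Suc n) [j] = W k n @ (phi k ^^ n) [Suc j]"
proof -
  have "phi k [j] = [0] @ [Suc j]"
    using assms by (simp add: phi_def phi_letter_def)
  then show ?thesis
    by (simp only: funpow_Suc_right comp_apply phi_pow_append W_def)
qed

lemma phi_pow_Suc_last_letter: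
  assumes "k \<ge> 2"
  shows "(phi k ^^ Suc n) [k - 1] = shift_word k (W k n)"
proof -
  have "phi k [k - 1] = shift_word k [0]"
    using assms by (simp add: phi_def phi_letter_def shift_word_def Let_def)
  then show ?thesis
    using assms by (simp only: funpow_Suc_right comp_apply W_def)
      (simp add: phi_pow_shift_word)
qed

section \<open>Generating functions\<close>

text \<open>Following every starting letter, not only 0, gives a recursion in \<open>j\<close>
  running from the wanted series at \<open>j = 0\<close> to a shifted copy at
  \<open>j = k - 1\<close>.\<close>

definition letter_gf :: "nat \<Rightarrow> nat list \<Rightarrow> nat \<Rightarrow> rat fps" where
  "letter_gf k B j = Abs_fps (\<lambda>n. of_nat (occurrences B ((phi k ^^ n) [j])))"

lemma letter_gf_0: "letter_gf k B 0 = C k B"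
  by (simp add: letter_gf_def C_def W_def)

text \<open>The last summand is the junction: \<open>W k m\<close> ends in \<open>m\<close>, so only
  \<open>m = x\<close> can count, which is the coefficient at \<open>Suc x\<close>. The constant
  coefficient vanishes because \<open>[j]\<close> is too short.\<close>

lemma letter_gf_step:
  assumes "k \<ge> 2" "j < k - 1"
  shows "letter_gf k [x, z] j = fps_X * C k [x, z] + fps_X * letter_gf k [x, z] (Suc j)
           + of_bool (hd ((phi k ^^ x) [Suc j]) = z) * fps_X ^ Suc x"
proof (rule fps_ext)
  fix n
  show "fps_nth (letter_gf k [x, z] j) n =
    fps_nth (fps_X * C k [x, z] + fps_X * letter_gf k [x, z] (Suc j)
           + of_bool (hd ((phi k ^^ x) [Suc j]) = z) * fps_X ^ Suc x) n"
  proof (cases n)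
    case 0
    then show ?thesis
      by (simp add: letter_gf_def occurrences_pair_Cons occurrences_pair_Nil)
  next
    case (Suc m)
    have "occurrences [x, z] ((phi k ^^ Suc m) [j]) =
        occurrences [x, z] (W k m) + occurrences [x, z] ((phi k ^^ m) [Suc j])
          + of_bool (m = x \<and> hd ((phi k ^^ m) [Suc j]) = z)"
      unfolding phi_pow_Suc_letter[OF assms(2)]
      by (subst occurrences_pair_append) (auto simp: W_def phi_pow_eq_Nil_iff last_W[unfolded W_def] assms)
    then show ?thesis
      unfolding Suc by (auto simp: letter_gf_def C_def simp del: funpow.simps)
  qed
qed

lemma C_pair_telescope:
  assumes "k \<ge> 2" "m \<le> k - 1"
  shows "C k [x, z] = (\<Sum>j = 1..m. fps_X ^ j) * C k [x, z] + fps_X ^ m * letter_gf k [x, z] m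
     + (\<Sum>j<m. of_bool (hd ((phi k ^^ x) [Suc j]) = z) * fps_X ^ (j + Suc x))"
  using assms(2)
proof (induction m)
  case 0
  then show ?case
    by (simp add: letter_gf_0)
next
  case (Suc m)
  have step: "letter_gf k [x, z] m = fps_X * C k [x, z] + fps_X * letter_gf k [x, z] (Suc m)
           + of_bool (hd ((phi k ^^ x) [Suc m]) = z) * fps_X ^ Suc x"
    using Suc.prems assms(1) by (intro letter_gf_step) auto
  have "C k [x, z] = (\<Sum>j = 1..m. fps_X ^ j) * C k [x, z] + fps_X ^ m * letter_gf k [x, z] m
     + (\<Sum>j<m. of_bool (hd ((phi k ^^ x) [Suc j]) = z) * fps_X ^ (j + Suc x))"
    using Suc by simp
  then show ?case
    unfolding step by (simp add: algebra_simps power_add)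
qed

lemma H_mult_eq_1: "H m * (1 - (\<Sum>j = 1..m. fps_X ^ j)) = 1"
proof -
  \<comment> \<open>The sum starts at \<open>j = 1\<close>, so the denominator has constant term 1
    and is invertible.\<close>
  have "fps_nth (1 - (\<Sum>j = 1..m. fps_X ^ j) :: rat fps) 0 = 1"
    by (simp add: fps_sum_nth)
  then show ?thesis
    unfolding H_def by (simp add: fps_divide_unit inverse_mult_eq_1)
qed

lemma eq_H_mult:
  assumes "F = (\<Sum>j = 1..m. fps_X ^ j) * F + R"
  shows "F = H m * R"
proof -
  have "(1 - (\<Sum>j = 1..m. fps_X ^ j)) * F = R"
    using assms by (simp add: algebra_simps)
  then have "H m * R = (H m * (1 - (\<Sum>j = 1..m. fps_X ^ j))) * F"
    by (simp add: mult.assoc)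
  then show ?thesis
    by (simp only: H_mult_eq_1 mult_1)
qed

lemma C_pair:
  assumes "k \<ge> 2"
  shows "C k [x, z] = H (k - 1) * (fps_X ^ (k - 1) * letter_gf k [x, z] (k - 1)
     + (\<Sum>j<k - 1. of_bool (hd ((phi k ^^ x) [Suc j]) = z) * fps_X ^ (j + Suc x)))"
  by (rule eq_H_mult) (use C_pair_telescope[OF assms order_refl] in \<open>simp add: add.assoc\<close>)

lemma letter_gf_last_shift:
  assumes "k \<ge> 2"
  shows "letter_gf k [k + x, k + z] (k - 1) = fps_X * C k [x, z]"
proof (rule fps_ext)
  fix n
  show "fps_nth (letter_gf k [k + x, k + z] (k - 1)) n = fps_nth (fps_X * C k [x, z]) n"
  proof (cases n)
    case 0
    then show ?thesis
      by (simp add: letter_gf_def occurrences_pair_Cons occurrences_pair_Nil)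
  next
    case (Suc m)
    have "occurrences [k + x, k + z] (shift_word k (W k m)) = occurrences [x, z] (W k m)"
      using occurrences_shift_word[of k "[x, z]" "W k m"] by (simp add: shift_word_def)
    then show ?thesis
      unfolding Suc letter_gf_def C_def fps_nth_Abs_fps phi_pow_Suc_last_letter[OF assms] by simp
  qed
qed

text \<open>After the first step every iterate of \<open>[k - 1]\<close> is a word shifted by
  \<open>k\<close>, so a letter below \<open>k\<close> cannot occur in it.\<close>

lemma letter_gf_last_eq_0:
  assumes "k \<ge> 2" "y \<in> {x, z}" "y < k"
  shows "letter_gf k [x, z] (k - 1) = 0"
proof (rule fps_ext)
  fix n
  show "fps_nth (letter_gf k [x, z] (k - 1)) n = fps_nth 0 n"
  proof (cases n)
    case 0
    then show ?thesis
      by (simp add: letter_gf_def occurrences_pair_Cons occurrences_pair_Nil)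
  next
    case (Suc m)
    have "occurrences [x, z] (shift_word k (W k m)) = 0"
      using assms(2,3) by (intro occurrences_eq_0[of y]) (auto simp: shift_word_def)
    then show ?thesis
      unfolding Suc letter_gf_def fps_nth_Abs_fps phi_pow_Suc_last_letter[OF assms(1)] by simp
  qed
qed

section \<open>The series \<open>G\<close> as a rational function\<close>

lemma g_initial_sum: "n < m \<Longrightarrow> n > 0 \<Longrightarrow> (\<Sum>j<n. g m j) + 1 = g m n"
proof (induction n)
  case (Suc n)
  then show ?case
    \<comment> \<open>Doubling starts only at \<open>n = 1\<close>; for \<open>n = 0\<close> we have
      \<open>g m 0 = 0\<close>, and the added 1 supplies \<open>g m 1 = 1\<close>.\<close>
    by (cases n) (simp_all add: g.simps)
qed simp

lemma fps_X_sum_mult_nth: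
  "fps_nth ((\<Sum>j = 1..m. fps_X ^ j) * F) n = (\<Sum>j = 1..m. if n < j then 0 else fps_nth F (n - j))"
  for F :: "rat fps"
  by (simp add: sum_distrib_right fps_sum_nth fps_X_power_mult_nth)

text \<open>With zeros at negative indices, the recurrence for \<open>g\<close> holds everywhere
  except for a defect of 1 when \<open>1 \<le> n < m\<close>; these defects form the
  numerator.\<close>

lemma G_eq_H_mult: "G m = H m * (\<Sum>j = 1..<m. fps_X ^ j)"
proof (rule eq_H_mult, rule fps_ext)
  fix n
  have poly: "fps_nth (\<Sum>j = 1..<m. fps_X ^ j :: rat fps) n = of_bool (1 \<le> n \<and> n < m)"
    by (simp add: fps_sum_nth)
  have conv: "fps_nth ((\<Sum>j = 1..m. fps_X ^ j) * G m) n =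
      of_nat (\<Sum>j = 1..m. if n < j then 0 else g m (n - j))"
    unfolding fps_X_sum_mult_nth of_nat_sum by (intro sum.cong) (auto simp: G_def)
  have "g m n = (\<Sum>j = 1..m. if n < j then 0 else g m (n - j)) + of_bool (1 \<le> n \<and> n < m)"
  proof (cases "1 \<le> n \<and> n < m")
    case True
    have "(\<Sum>j = 1..m. if n < j then 0 else g m (n - j)) = (\<Sum>j = 1..n. g m (n - j))"
      using True by (intro sum.mono_neutral_cong_right) auto
    also have "\<dots> = (\<Sum>j<n. g m j)"
      by (rule sum.reindex_bij_witness[of _ "\<lambda>j. n - j" "\<lambda>j. n - j"]) auto
    finally show ?thesis
      using True g_initial_sum[of n m] by simp
  next
    case False
    then consider "n = 0" | "n \<ge> m" "n > 0"
      by linarith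
    then show ?thesis
    proof cases
      case 1
      then show ?thesis
        by (simp add: g.simps)
    next
      case 2
      then have "g m n = (\<Sum>j = 1..m. g m (n - j))"
        by (subst g.simps) simp
      also have "\<dots> = (\<Sum>j = 1..m. if n < j then 0 else g m (n - j))"
        using 2 by (intro sum.cong) auto
      finally show ?thesis
        using False by simp
    qed
  qed
  then show "fps_nth (G m) n =
      fps_nth ((\<Sum>j = 1..m. fps_X ^ j) * G m + (\<Sum>j = 1..<m. fps_X ^ j)) n"
    unfolding fps_add_nth poly conv by (simp add: G_def)
qed

section \<open>Series of the words \<open>[b, 0]\<close>, \<open>[a, k]\<close> and their
  shifts\<close>

lemma C_pair_0:
  assumes "k \<ge> 2"
  shows "C k [b, 0] = of_bool (b > 0) * fps_X ^ b * G (k - 1)"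
proof (cases "b = 0")
  case True
  \<comment> \<open>For \<open>b = 0\<close> the letter after the junction is \<open>Suc j\<close>
    itself, never 0.\<close>
  then show ?thesis
    using assms C_pair[OF assms, of 0 0] letter_gf_last_eq_0[OF assms, of 0 0 0] by simp
next
  case False
  have "(\<Sum>j<k - 1. of_bool (hd ((phi k ^^ b) [Suc j]) = 0) * fps_X ^ (j + Suc b)) =
      (\<Sum>j<k - 2. fps_X ^ (j + Suc b) :: rat fps)"
    \<comment> \<open>Only \<open>j = k - 2\<close> drops out: there \<open>Suc j = k - 1\<close>,
      whose image begins with \<open>k\<close> and not with 0.\<close>
    using assms False by (intro sum.mono_neutral_cong_right) (auto simp: hd_phi_pow)
  also have "\<dots> = fps_X ^ b * (\<Sum>j<k - 2. fps_X ^ Suc j)"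
    by (simp add: sum_distrib_left power_add mult_ac)
  also have "(\<Sum>j<k - 2. fps_X ^ Suc j :: rat fps) = (\<Sum>j = 1..<k - 1. fps_X ^ j)"
    by (rule sum.reindex_bij_witness[of _ "\<lambda>j. j - 1" Suc]) auto
  finally show ?thesis
    using False assms C_pair[OF assms, of b 0] letter_gf_last_eq_0[OF assms, of 0 b 0]
    by (simp add: G_eq_H_mult mult_ac)
qed

lemma C_pair_k:
  assumes "k \<ge> 3" "a \<ge> 1"
  shows "C k [a, k] = fps_X ^ a * H (k - 1) * (fps_X ^ (k - 1) + of_bool (a > k) * G (k - 1))"
proof -
  have k2: "k \<ge> 2"
    using assms by simp
  \<comment> \<open>Here, conversely, only \<open>j = k - 2\<close> survives, since
    \<open>a \<ge> 1\<close> makes all other images begin with 0.\<close>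
  have "(\<Sum>j<k - 1. of_bool (hd ((phi k ^^ a) [Suc j]) = k) * fps_X ^ (j + Suc a)) =
      (\<Sum>j\<in>{k - 2}. fps_X ^ (j + Suc a) :: rat fps)"
    using assms by (intro sum.mono_neutral_cong_right) (auto simp: hd_phi_pow split: if_splits)
  also have "\<dots> = fps_X ^ (k - 2 + Suc a)"
    by (simp only: sum.insert finite.emptyI empty_iff not_False_eq_True sum.empty add_0_right)
  also have "k - 2 + Suc a = a + (k - 1)"
    using assms by simp
  finally have junction: "(\<Sum>j<k - 1. of_bool (hd ((phi k ^^ a) [Suc j]) = k) * fps_X ^ (j + Suc a)) =
      (fps_X ^ (a + (k - 1)) :: rat fps)" .
  have "fps_X ^ (k - 1) * letter_gf k [a, k] (k - 1) = of_bool (a > k) * fps_X ^ a * G (k - 1)"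
  \<comment> \<open>The boundary \<open>a = k\<close> belongs to the second case: there
    \<open>b = 0\<close>, and \<open>C_pair_0\<close> gives zero.\<close>
  proof (cases "a < k")
    case True
    then show ?thesis
      using letter_gf_last_eq_0[OF k2, of a a k] by simp
  next
    case False
    then obtain b where b: "a = k + b"
      using le_Suc_ex not_less by blast
    have "fps_X ^ (k - 1) * letter_gf k [a, k] (k - 1) = fps_X ^ (k - 1) * fps_X * C k [b, 0]"
      using letter_gf_last_shift[OF k2, of b 0] b by (simp add: mult.assoc)
    also have "fps_X ^ (k - 1) * fps_X = (fps_X ^ k :: rat fps)"
      using power_Suc2[of "fps_X :: rat fps" "k - 1"] assms by simp
    finally show ?thesis
      unfolding C_pair_0[OF k2] b by (simp add: power_add mult_ac)
  qed
  then show ?thesis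
    unfolding C_pair[OF k2] junction by (simp add: power_add algebra_simps)
qed

text \<open>No junction contributes, because the word after it begins with 0 or \<open>k\<close>,
  both less than \<open>k + z\<close>. The power \<open>fps_X ^ k\<close> collects
  \<open>k - 1\<close> telescoping steps and the one step that turns \<open>[k - 1]\<close> into
  \<open>[k]\<close>.\<close>

lemma C_pair_shift:
  assumes "k \<ge> 2" "z > 0"
  shows "C k [k + x, k + z] = fps_X ^ k * H (k - 1) * C k [x, z]"
proof -
  have "hd ((phi k ^^ (k + x)) [Suc j]) \<noteq> k + z" if "j < k - 1" for j
    using that assms by (subst hd_phi_pow) auto
  then have "(\<Sum>j<k - 1. of_bool (hd ((phi k ^^ (k + x)) [Suc j]) = k + z) * fps_X ^ (j + Suc (k + x)))
      = (0 :: rat fps)"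
    by (intro sum.neutral) auto
  then have "C k [k + x, k + z] = H (k - 1) * (fps_X ^ (k - 1) * fps_X * C k [x, z])"
    by (simp only: C_pair[OF assms(1), of "k + x" "k + z"] letter_gf_last_shift[OF assms(1)]
        add_0_right mult.assoc)
  also have "fps_X ^ (k - 1) * fps_X = (fps_X ^ k :: rat fps)"
    using power_Suc2[of "fps_X :: rat fps" "k - 1"] assms by simp
  finally show ?thesis
    by (simp add: mult_ac)
qed

theorem theorem5p11:
  fixes k a i :: nat and B :: "nat list"
  assumes "k \<ge> 3" and "a \<ge> 1"
    and "B = shift_word (k * i) [a, k]"
  shows "C k B = fps_X ^ (a + k * i) * H (k - 1) ^ (i + 1)
           * (fps_X ^ (k - 1) + of_bool (a > k) * G (k - 1))"
proof -
  have "C k [k * i + a, k * i + k] = fps_X ^ (a + k * i) * H (k - 1) ^ (i + 1)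
           * (fps_X ^ (k - 1) + of_bool (a > k) * G (k - 1))"
  proof (induction i)
    case 0
    then show ?case
      using C_pair_k[OF assms(1,2)] by simp
  next
    case (Suc i)
    have "C k [k * Suc i + a, k * Suc i + k] =
        fps_X ^ k * H (k - 1) * C k [k * i + a, k * i + k]"
      using C_pair_shift[of k "k * i + k" "k * i + a"] assms(1) by (simp add: add.assoc)
    then show ?case
      unfolding Suc.IH by (simp add: power_add mult_ac)
  qed
  then show ?thesis
    by (simp add: assms(3) shift_word_def)
qed

end
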